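(* Let $m\geq 3$ and let $G=S(2^2,1^{m-2})$ be the starlike tree of order $m+3$ (the tree on vertices $o,x_1,\dots,x_m,y,z$ with edges $ox_1,\dots,ox_m,x_1y,x_2z$). Then $b(G)=\frac{m^2+m-4}{2}$.
   Context: All graphs are finite and simple. For vertices $u,v$ of a graph $G$, $d_G(u,v)$ is the length of a shortest $u$–$v$ path. For an edge $xy$ of $G$, $W^G_{xy}=\{u\in V(G): d_G(u,x)<d_G(u,y)\}$. A graph is distance-balanced if $|W^G_{xy}|=|W^G_{yx}|$ for every edge $xy$. For a graph $H$, $b(H)$ is the smallest number of edges which can be added to $H$ (keeping the vertex set) so that the resulting graph is distance-balanced. A starlike tree is a tree with exactly one vertex of degree greater than two; $S(n_1^{\alpha_1},\dots,n_k^{\alpha_k})$ denotes the starlike tree in which deleting the central vertex leaves $\alpha_i$ paths with $n_i$ vertices for each $i$. *)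

theory Defs
  imports Complex_Main "HOL-Library.Multiset" "HOL-Library.Extended_Nat"
begin

datatype 'a graph = Graph (verts: "'a set") (edges: "'a set set")

definition simple_graph :: "'a graph \<Rightarrow> bool" where
  "simple_graph G \<longleftrightarrow>
     finite (verts G) \<and> (\<forall>e\<in>edges G. e \<subseteq> verts G \<and> card e = 2)"

definition degree :: "'a graph \<Rightarrow> 'a \<Rightarrow> nat" where
  "degree G v = card {e \<in> edges G. v \<in> e}"

text \<open>A path is the list of its (pairwise distinct) vertices; its length is the number of
  edges, i.e. one less than the length of the list.\<close>

definition path :: "'a graph \<Rightarrow> 'a list \<Rightarrow> bool" where
  "path G p \<longleftrightarrow>
     p \<noteq> [] \<and> distinct p \<and> set p \<subseteq> verts G \<and>
     (\<forall>i. Suc i < length p \<longrightarrow> {p ! i, p ! Suc i} \<in> edges G)"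

definition path_between :: "'a graph \<Rightarrow> 'a \<Rightarrow> 'a \<Rightarrow> 'a list \<Rightarrow> bool" where
  "path_between G u v p \<longleftrightarrow> path G p \<and> hd p = u \<and> last p = v"

definition connected_graph :: "'a graph \<Rightarrow> bool" where
  "connected_graph G \<longleftrightarrow> (\<forall>u\<in>verts G. \<forall>v\<in>verts G. \<exists>p. path_between G u v p)"

definition cycle :: "'a graph \<Rightarrow> 'a list \<Rightarrow> bool" where
  "cycle G p \<longleftrightarrow> path G p \<and> 3 \<le> length p \<and> {last p, hd p} \<in> edges G"

definition tree :: "'a graph \<Rightarrow> bool" where
  "tree G \<longleftrightarrow>
     simple_graph G \<and> verts G \<noteq> {} \<and> connected_graph G \<and> (\<nexists>p. cycle G p)"

definition induced_subgraph :: "'a graph \<Rightarrow> 'a set \<Rightarrow> 'a graph" where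
  "induced_subgraph G U = Graph (verts G \<inter> U) {e \<in> edges G. e \<subseteq> U}"

definition delete_vertex :: "'a graph \<Rightarrow> 'a \<Rightarrow> 'a graph" where
  "delete_vertex G c = induced_subgraph G (verts G - {c})"

text \<open>Vertex sets of the connected components.\<close>

definition components :: "'a graph \<Rightarrow> 'a set set" where
  "components G = (\<lambda>u. {v \<in> verts G. \<exists>p. path_between G u v p}) ` verts G"

definition path_graph :: "'a graph \<Rightarrow> bool" where
  "path_graph G \<longleftrightarrow>
     (\<exists>p. p \<noteq> [] \<and> distinct p \<and> verts G = set p \<and>
          edges G = {{p ! i, p ! Suc i} | i. Suc i < length p})"

text \<open>\<open>starlike G N\<close>: the graph \<open>G\<close> is a starlike tree whose central vertex \<open>c\<close>, when deleted,
  leaves paths whose numbers of vertices form the multiset \<open>N\<close>. Thus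
  \<open>S(n\<^sub>1\<^sup>\<alpha>\<^sub>1, \<dots>, n\<^sub>k\<^sup>\<alpha>\<^sub>k)\<close> has \<open>N\<close> consisting of \<open>\<alpha>\<^sub>i\<close> copies of \<open>n\<^sub>i\<close> for each \<open>i\<close>.\<close>

definition starlike :: "'a graph \<Rightarrow> nat multiset \<Rightarrow> bool" where
  "starlike G N \<longleftrightarrow>
     tree G \<and>
     (\<exists>c. {v \<in> verts G. degree G v > 2} = {c} \<and>
          (\<forall>C\<in>components (delete_vertex G c). path_graph (induced_subgraph (delete_vertex G c) C)) \<and>
          image_mset card (mset_set (components (delete_vertex G c))) = N)"

text \<open>The value is \<open>\<infinity>\<close> if no path exists.\<close>

definition gdist :: "'a graph \<Rightarrow> 'a \<Rightarrow> 'a \<Rightarrow> enat" where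
  "gdist G u v = (INF p\<in>{p. path_between G u v p}. enat (length p - 1))"

definition closer :: "'a graph \<Rightarrow> 'a \<Rightarrow> 'a \<Rightarrow> 'a set" where
  "closer G x y = {u \<in> verts G. gdist G u x < gdist G u y}"

definition distance_balanced :: "'a graph \<Rightarrow> bool" where
  "distance_balanced G \<longleftrightarrow>
     (\<forall>x y. {x, y} \<in> edges G \<longrightarrow> card (closer G x y) = card (closer G y x))"

definition non_edges :: "'a graph \<Rightarrow> 'a set set" where
  "non_edges G = {e. e \<subseteq> verts G \<and> card e = 2} - edges G"

definition add_edges :: "'a graph \<Rightarrow> 'a set set \<Rightarrow> 'a graph" where
  "add_edges G F = Graph (verts G) (edges G \<union> F)"

text \<open>\<open>b(H)\<close>; for a simple graph the minimum exists since complete graphs are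
  distance-balanced.\<close>

definition db_number :: "'a graph \<Rightarrow> nat" where
  "db_number H =
     (LEAST k. \<exists>F. F \<subseteq> non_edges H \<and> card F = k \<and> distance_balanced (add_edges H F))"

end

theory Submission
  imports Defs
begin

text \<open>In a distance-balanced graph \<open>H\<close>, if all vertices are within distance 2 of \<open>x\<close>, then every
  neighbour \<open>y\<close> of \<open>x\<close> has degree \<open>deg x\<close> plus the number of vertices at distance at least 3 from \<open>y\<close>.
  Let \<open>H\<close> be a distance-balanced supergraph of \<open>G\<close> and take \<open>x\<close> to be the centre \<open>o\<close>, of degree at
  least \<open>m\<close>. If some \<open>u\<close> were at distance at least 3 from a neighbour \<open>v\<close> of \<open>o\<close>, then \<open>v\<close> would be
  adjacent neither to \<open>u\<close> nor to a common neighbour of \<open>u\<close> and \<open>o\<close>, so \<open>deg v\<close> would be at most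
  \<open>m\<close>, although it exceeds \<open>deg o\<close>. Hence the same degree formula applies with \<open>x = v\<close>, all degrees in
  \<open>H\<close> are at least \<open>m\<close>, and \<open>H\<close> has at least \<open>m(m+3)/2\<close> edges.

  The bound is attained because \<open>G\<close> is bipartite with parts \<open>{o, y, z}\<close> and \<open>{x\<^sub>1, \<dots>, x\<^sub>m}\<close>: the join of
  three isolated vertices with the complement of a 2-regular graph on the \<open>x\<^sub>i\<close> is \<open>m\<close>-regular of
  diameter 2, hence distance-balanced.\<close>

section \<open>Neighbourhoods, degrees and edge counts\<close>

definition nbrs :: "'a graph \<Rightarrow> 'a \<Rightarrow> 'a set" where
  "nbrs G v = {u. {v, u} \<in> edges G}"

text \<open>Unreachable vertices count as far, since their distance is infinite; thus
  \<open>far G v = {}\<close> also says that everything is reachable from \<open>v\<close>. The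
  negated strict bound has the shape that \<open>gdist_less_3\<close> characterises.\<close>

definition far :: "'a graph \<Rightarrow> 'a \<Rightarrow> 'a set" where
  "far G v = {u \<in> verts G. \<not> gdist G u v < enat 3}"

lemma nbrs_sym: "u \<in> nbrs G v \<longleftrightarrow> v \<in> nbrs G u"
  by (simp add: nbrs_def insert_commute)

lemma edgeD:
  assumes "simple_graph G" "{u, v} \<in> edges G"
  shows "u \<in> verts G" "v \<in> verts G" "u \<noteq> v"
proof -
  have *: "{u, v} \<subseteq> verts G \<and> card {u, v} = 2"
    using assms unfolding simple_graph_def by blast
  then show "u \<in> verts G" "v \<in> verts G" by auto
  show "u \<noteq> v" using * by auto
qed

lemma nbrs_subset: "simple_graph G \<Longrightarrow> nbrs G v \<subseteq> verts G - {v}"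
  by (auto simp: nbrs_def dest: edgeD)

lemma finite_nbrs: "simple_graph G \<Longrightarrow> finite (nbrs G v)"
  by (meson finite_Diff finite_subset nbrs_subset simple_graph_def)

lemma finite_edges: "simple_graph G \<Longrightarrow> finite (edges G)"
  by (rule finite_subset[of _ "Pow (verts G)"]) (auto simp: simple_graph_def)

lemma card_nbrs: "simple_graph G \<Longrightarrow> card (nbrs G v) = degree G v"
proof -
  assume s: "simple_graph G"
  have "bij_betw (\<lambda>u. {v, u}) (nbrs G v) {e \<in> edges G. v \<in> e}"
  proof (rule bij_betwI')
    fix e assume e: "e \<in> {e \<in> edges G. v \<in> e}"
    then have "card e = 2" using s by (auto simp: simple_graph_def)
    then obtain a b where "e = {a, b}" by (meson card_2_iff)
    then show "\<exists>u\<in>nbrs G v. e = {v, u}"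
      using e by (auto simp: nbrs_def insert_commute)
  qed (auto simp: nbrs_def doubleton_eq_iff)
  then show ?thesis by (simp add: bij_betw_same_card degree_def)
qed

lemma handshake:
  assumes "simple_graph G"
  shows "(\<Sum>v\<in>verts G. degree G v) = 2 * card (edges G)"
  unfolding degree_def
proof (rule sum_multicount)
  show "\<forall>e\<in>edges G. card {v \<in> verts G. v \<in> e} = 2"
  proof
    fix e assume "e \<in> edges G"
    then have "e \<subseteq> verts G" "card e = 2" using assms by (auto simp: simple_graph_def)
    moreover from this have "{v \<in> verts G. v \<in> e} = e" by auto
    ultimately show "card {v \<in> verts G. v \<in> e} = 2" by simp
  qed
qed (use assms finite_edges in \<open>auto simp: simple_graph_def\<close>)

section \<open>Distances 0, 1 and 2 in terms of adjacency\<close>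

text \<open>A strict upper bound on an infimum amounts to a single path below it, so no shortest
  path has to be chosen and the infinite case needs no separate treatment.\<close>

lemma gdist_less_iff:
  "gdist G u v < enat k \<longleftrightarrow> (\<exists>p. path_between G u v p \<and> length p - 1 < k)"
  by (auto simp: gdist_def INF_less_iff)

lemma path_Cons_Cons:
  "path G (a # b # p) \<longleftrightarrow> a \<in> verts G \<and> a \<notin> set (b # p) \<and> {a, b} \<in> edges G \<and> path G (b # p)"
proof -
  have "(\<forall>i. Suc i < length (a # b # p) \<longrightarrow> {(a # b # p) ! i, (a # b # p) ! Suc i} \<in> edges G) \<longleftrightarrow>
   {a, b} \<in> edges G \<and> (\<forall>i. Suc i < length (b # p) \<longrightarrow> {(b # p) ! i, (b # p) ! Suc i} \<in> edges G)"
   (is "(\<forall>i. ?P i) \<longleftrightarrow> _")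
  proof -
    have "(\<forall>i. ?P i) \<longleftrightarrow> ?P 0 \<and> (\<forall>i. ?P (Suc i))" by (metis not0_implies_Suc)
    then show ?thesis by simp
  qed
  then show ?thesis unfolding path_def by auto
qed

lemma path_single: "path G [a] \<longleftrightarrow> a \<in> verts G" by (simp add: path_def)

lemma path_between_singleton: "path_between G u v [a] \<longleftrightarrow> u \<in> verts G \<and> u = v \<and> a = u"
  by (auto simp: path_between_def path_def)

lemma path_between_pair:
  "path_between G u v [a, b] \<longleftrightarrow>
     u \<in> verts G \<and> v \<in> verts G \<and> u \<noteq> v \<and> {u, v} \<in> edges G \<and> a = u \<and> b = v"
  by (auto simp: path_between_def path_Cons_Cons path_single)

lemma path_between_triple:
  "path_between G u v [a, w, b] \<longleftrightarrow>
     {u, w, v} \<subseteq> verts G \<and> distinct [u, w, v] \<and> {u, w} \<in> edges G \<and> {w, v} \<in> edges G \<and> a = u \<and> b = v"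
  by (auto simp: path_between_def path_Cons_Cons path_single)

lemma path_between_Nil: "\<not> path_between G u v []"
  by (auto simp: path_between_def path_def)

lemma gdist_less_1:
  "gdist G u v < enat 1 \<longleftrightarrow> u \<in> verts G \<and> u = v"
proof
  assume "gdist G u v < enat 1"
  then obtain p where p: "path_between G u v p" "length p < 2"
    by (auto simp: gdist_less_iff)
  then obtain a where "p = [a]"
    using p path_between_Nil[of G u v] by (cases p; cases "tl p") auto
  with p show "u \<in> verts G \<and> u = v" by (auto simp: path_between_singleton)
next
  assume "u \<in> verts G \<and> u = v"
  then show "gdist G u v < enat 1"
    unfolding gdist_less_iff by (intro exI[of _ "[u]"]) (auto simp: path_between_singleton)
qed

lemma gdist_less_2:
  assumes "simple_graph G"
  shows "gdist G u v < enat 2 \<longleftrightarrow> u \<in> verts G \<and> (u = v \<or> u \<in> nbrs G v)"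
proof
  assume "gdist G u v < enat 2"
  then obtain p where p: "path_between G u v p" "length p < 3"
    by (auto simp: gdist_less_iff)
  then obtain a b where "p = [a] \<or> p = [a, b]"
    using p path_between_Nil[of G u v] by (cases p; cases "tl p"; cases "tl (tl p)") auto
  with p show "u \<in> verts G \<and> (u = v \<or> u \<in> nbrs G v)"
    by (auto simp: path_between_singleton path_between_pair nbrs_def insert_commute)
next
  assume r: "u \<in> verts G \<and> (u = v \<or> u \<in> nbrs G v)"
  show "gdist G u v < enat 2"
  proof (cases "u = v")
    case True
    with r show ?thesis
      unfolding gdist_less_iff by (intro exI[of _ "[u]"]) (auto simp: path_between_singleton)
  next
    case False
    with r have "{u, v} \<in> edges G" by (auto simp: nbrs_def insert_commute)
    then show ?thesis
      using edgeD[OF assms] unfolding gdist_less_iff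
      by (intro exI[of _ "[u, v]"]) (simp add: path_between_pair)
  qed
qed

lemma gdist_less_3:
  assumes "simple_graph G"
  shows "gdist G u v < enat 3 \<longleftrightarrow>
    u \<in> verts G \<and> (u = v \<or> u \<in> nbrs G v \<or> (\<exists>w. w \<in> nbrs G u \<and> w \<in> nbrs G v))"
    (is "_ \<longleftrightarrow> ?R")
proof
  assume "gdist G u v < enat 3"
  then obtain p where p: "path_between G u v p" "length p < 4"
    by (auto simp: gdist_less_iff)
  then obtain a b w where "p = [a] \<or> p = [a, b] \<or> p = [a, w, b]"
    using p path_between_Nil[of G u v]
    by (cases p; cases "tl p"; cases "tl (tl p)"; cases "tl (tl (tl p))") auto
  with p show ?R
    by (auto simp: path_between_singleton path_between_pair path_between_triple nbrs_def insert_commute)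
next
  assume r: ?R
  show "gdist G u v < enat 3"
  proof (cases "u = v \<or> u \<in> nbrs G v")
    case True
    then have "gdist G u v < enat 2" using r gdist_less_2[OF assms] by blast
    also have "enat 2 < enat 3" by simp
    finally show ?thesis .
  next
    case False
    with r obtain w where w: "{u, w} \<in> edges G" "{w, v} \<in> edges G" "u \<noteq> v"
      by (auto simp: nbrs_def insert_commute)
    then have "path_between G u v [u, w, v]"
      using edgeD[OF assms w(1)] edgeD[OF assms w(2)] by (simp add: path_between_triple)
    then show ?thesis
      unfolding gdist_less_iff by (intro exI[of _ "[u, w, v]"]) simp
  qed
qed

section \<open>Balance along an edge with one end close to everything\<close>

text \<open>If \<open>a\<close> is at most 2, then \<open>a < b\<close> is witnessed by one of the
  thresholds 1, 2, 3 separating the two values; \<open>a\<close> always passes the last one. When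
  \<open>b\<close> is at most 2, the last threshold cannot separate.\<close>

lemma enat_less_iff_of_left:
  assumes "a < enat 3"
  shows "a < b \<longleftrightarrow> a < enat 1 \<and> \<not> b < enat 1 \<or> a < enat 2 \<and> \<not> b < enat 2 \<or> \<not> b < enat 3"
  using assms by (cases a; cases b) auto

lemma enat_less_iff_of_right:
  assumes "b < enat 3"
  shows "a < b \<longleftrightarrow> a < enat 1 \<and> \<not> b < enat 1 \<or> a < enat 2 \<and> \<not> b < enat 2"
  using assms by (cases a; cases b) auto

text \<open>All distances to \<open>x\<close> are at most 2 and those to \<open>y\<close> differ
  from them by at most 1. So a vertex is closer to \<open>x\<close> when it is \<open>x\<close>
  itself, or is a neighbour of \<open>x\<close> other than \<open>y\<close> and not adjacent to
  \<open>y\<close>, or has distances 2 and 3; the last kind is \<open>far G y\<close> and has no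
  counterpart on the side of \<open>y\<close>.\<close>

lemma closer_near:
  assumes s: "simple_graph G" and e: "x \<in> nbrs G y" and f: "far G x = {}"
  shows "card (closer G x y) = card (nbrs G x - nbrs G y) + card (far G y)"
    and "card (closer G y x) = card (nbrs G y - nbrs G x)"
proof -
  have e': "y \<in> nbrs G x" using e nbrs_sym by metis
  have xy: "x \<in> verts G" "y \<in> verts G" "x \<noteq> y" using nbrs_subset[OF s] e e' by blast+
  have near: "gdist G u x < enat 3" if "u \<in> verts G" for u using f that by (auto simp: far_def)
  have fin: "finite (nbrs G x)" "finite (nbrs G y)" using finite_nbrs[OF s] by auto
  have finf: "finite (far G y)" using s by (auto simp: far_def simple_graph_def)
  have V: "nbrs G x \<subseteq> verts G" "nbrs G y \<subseteq> verts G" "x \<notin> nbrs G x" "y \<notin> nbrs G y"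
    using nbrs_subset[OF s] by blast+
  have near_nbrs: "far G y \<inter> nbrs G x = {}"
    using gdist_less_3[OF s] e nbrs_sym[of _ G x] by (fastforce simp: far_def)
  have near_x: "x \<notin> far G y"
    using gdist_less_3[OF s] e xy by (auto simp: far_def)
  have far_y: "far G y \<inter> nbrs G y = {}" "y \<notin> far G y"
    using gdist_less_3[OF s] by (auto simp: far_def)
  have "gdist G u x < gdist G u y \<longleftrightarrow>
      u = x \<or> u \<in> nbrs G x \<and> u \<notin> nbrs G y \<and> u \<noteq> y \<or> u \<in> far G y" if "u \<in> verts G" for u
    unfolding enat_less_iff_of_left[OF near[OF that]] gdist_less_1 gdist_less_2[OF s]
    using that xy e by (auto simp: far_def)
  then have "closer G x y = insert x (nbrs G x - nbrs G y - {y}) \<union> far G y"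
    unfolding closer_def using V xy by (auto simp: far_def)
  also have "card \<dots> = card (insert x (nbrs G x - nbrs G y - {y})) + card (far G y)"
    using fin finf near_nbrs near_x by (intro card_Un_disjoint) auto
  \<comment> \<open>\<open>y\<close> is in \<open>nbrs G x - nbrs G y\<close> but not closer to
    \<open>x\<close>, while \<open>x\<close> is closer to itself but not its own neighbour.
    Exchanging the two keeps the size.\<close>
  also have "card (insert x (nbrs G x - nbrs G y - {y})) = card (insert y (nbrs G x - nbrs G y - {y}))"
    using fin V by (metis (no_types, lifting) card_insert_disjoint Diff_iff finite_Diff singletonI)
  also have "insert y (nbrs G x - nbrs G y - {y}) = nbrs G x - nbrs G y"
    using e' V by auto
  finally show "card (closer G x y) = card (nbrs G x - nbrs G y) + card (far G y)" .
  have "gdist G u y < gdist G u x \<longleftrightarrow> u = y \<or> u \<in> nbrs G y \<and> u \<notin> nbrs G x \<and> u \<noteq> x"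
    if "u \<in> verts G" for u
    unfolding enat_less_iff_of_right[OF near[OF that]] gdist_less_1 gdist_less_2[OF s]
    using that xy e' by auto
  then have "closer G y x = insert y (nbrs G y - nbrs G x - {x})"
    unfolding closer_def using V xy by auto
  also have "card \<dots> = card (insert x (nbrs G y - nbrs G x - {x}))"
    using fin V by (metis (no_types, lifting) card_insert_disjoint Diff_iff finite_Diff singletonI)
  also have "insert x (nbrs G y - nbrs G x - {x}) = nbrs G y - nbrs G x"
    using e V by auto
  finally show "card (closer G y x) = card (nbrs G y - nbrs G x)" .
qed

lemma card_Diff_swap:
  assumes "finite A" "finite B"
  shows "card (A - B) + card B = card (B - A) + card A"
  using card_Int_Diff[OF assms(1), of B] card_Int_Diff[OF assms(2), of A] by (simp add: Int_commute)

text \<open>Common neighbours contribute equally to both degrees, so the sizes of the two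
  neighbourhood differences may be replaced by the degrees.\<close>

lemma balanced_edge_degree:
  assumes s: "simple_graph G" and b: "distance_balanced G"
    and e: "x \<in> nbrs G y" and f: "far G x = {}"
  shows "degree G y = degree G x + card (far G y)"
proof -
  have "{x, y} \<in> edges G" using e by (simp add: nbrs_def insert_commute)
  then have "card (closer G x y) = card (closer G y x)" using b by (auto simp: distance_balanced_def)
  then have "card (nbrs G x - nbrs G y) + card (far G y) = card (nbrs G y - nbrs G x)"
    using closer_near[OF s e f] by simp
  moreover have "card (nbrs G x - nbrs G y) + degree G y = card (nbrs G y - nbrs G x) + degree G x"
    using card_Diff_swap[of "nbrs G x" "nbrs G y"] finite_nbrs[OF s] card_nbrs[OF s] by simp
  ultimately show ?thesis by simp
qed

text \<open>With no far vertices at either end, the closer sets are as large as the two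
  neighbourhood differences, which agree in size when the degrees do.\<close>

lemma regular_diameter_2_balanced:
  assumes s: "simple_graph G" and r: "\<And>v. v \<in> verts G \<Longrightarrow> degree G v = d"
    and f: "\<And>v. v \<in> verts G \<Longrightarrow> far G v = {}"
  shows "distance_balanced G"
  unfolding distance_balanced_def
proof (intro allI impI)
  fix x y assume xy: "{x, y} \<in> edges G"
  then have e: "x \<in> nbrs G y" by (simp add: nbrs_def insert_commute)
  have V: "x \<in> verts G" "y \<in> verts G" using edgeD[OF s xy] by auto
  show "card (closer G x y) = card (closer G y x)"
    using closer_near[OF s e f[OF V(1)]] f[OF V(2)] r V
      card_Diff_swap[of "nbrs G x" "nbrs G y"] finite_nbrs[OF s] card_nbrs[OF s] by simp
qed

section \<open>The lower bound on the number of edges\<close>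

lemma balanced_degree_ge:
  assumes s: "simple_graph G" and b: "distance_balanced G"
    and n: "card (verts G) = m + 3" and c: "c \<in> verts G" "degree G c \<ge> m" "far G c = {}"
    and v: "v \<in> verts G"
  shows "degree G v \<ge> m"
proof -
  \<comment> \<open>Neighbours of \<open>c\<close> come first; they then serve as the close end of
    the edges that lead to distance 2.\<close>
  have near: "far G x = {} \<and> degree G x \<ge> m" if x: "x \<in> nbrs G c" for x
  proof -
    have deg: "degree G x = degree G c + card (far G x)"
      using balanced_edge_degree[OF s b _ c(3)] x nbrs_sym by metis
    have "far G x = {}"
    proof (rule ccontr)
      assume "far G x \<noteq> {}"
      then obtain u where u: "u \<in> far G x" by auto
      have "u \<in> verts G" "gdist G u c < enat 3" using u c(3) by (auto simp: far_def)
      moreover have *: "u \<noteq> x" "u \<notin> nbrs G x" "\<And>w. w \<in> nbrs G u \<Longrightarrow> w \<notin> nbrs G x"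
        using u gdist_less_3[OF s] by (auto simp: far_def)
      \<comment> \<open>Since \<open>x\<close> is adjacent to \<open>c\<close>, either alternative
        would put \<open>u\<close> within distance 2 of \<open>x\<close>. So \<open>u\<close> and
        \<open>c\<close> have a common neighbour \<open>w\<close>.\<close>
      moreover have "u \<noteq> c" "u \<notin> nbrs G c" using * x nbrs_sym[of _ G c] nbrs_sym[of x] by auto
      ultimately obtain w where w: "w \<in> nbrs G u" "w \<in> nbrs G c"
        using gdist_less_3[OF s] by blast
      have "w \<noteq> x" using w(1) * nbrs_sym by metis
      \<comment> \<open>\<open>w\<close> is excluded because it is adjacent to \<open>u\<close>,
        which would then be at distance 2 from \<open>x\<close>. Removing three of the m + 3
        vertices leaves at most m neighbours.\<close>
      have sub: "nbrs G x \<subseteq> verts G - {x, u, w}" using * w nbrs_subset[OF s] by fastforce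
      have "w \<noteq> u" using w(1) nbrs_subset[OF s, of u] by blast
      then have "card {x, u, w} = 3" using \<open>w \<noteq> x\<close> \<open>u \<noteq> x\<close> by simp
      moreover have "{x, u, w} \<subseteq> verts G" using x w nbrs_subset[OF s] \<open>u \<in> verts G\<close> by blast
      ultimately have "card (verts G - {x, u, w}) = m" using n
        by (simp add: card_Diff_subset)
      then have "degree G x \<le> m"
        using card_mono[OF _ sub] card_nbrs[OF s] s by (simp add: simple_graph_def)
      moreover have "card (far G x) > 0"
        using u s by (auto simp: card_gt_0_iff far_def simple_graph_def)
      ultimately show False using deg c(2) by simp
    qed
    then show ?thesis using deg c(2) by simp
  qed
  have "gdist G v c < enat 3" using v c(3) by (auto simp: far_def)
  then consider "v = c" | "v \<in> nbrs G c" | w where "w \<in> nbrs G v" "w \<in> nbrs G c"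
    using gdist_less_3[OF s] by blast
  then show ?thesis
  proof cases
    case 1 then show ?thesis using c by simp
  next
    case 2 then show ?thesis using near by simp
  next
    case 3
    then show ?thesis using balanced_edge_degree[OF s b 3(1)] near[OF 3(2)] by simp
  qed
qed

corollary balanced_edges_ge:
  assumes "simple_graph G" "distance_balanced G" "card (verts G) = m + 3"
    "c \<in> verts G" "degree G c \<ge> m" "far G c = {}"
  shows "2 * card (edges G) \<ge> m * (m + 3)"
  using handshake[OF assms(1)] sum_bounded_below[of "verts G" m "degree G"]
    balanced_degree_ge[OF assms] assms(3) by (simp add: mult.commute)

section \<open>A balanced supergraph attaining the bound\<close>

text \<open>All of \<open>X\<close> is arranged in a single cycle. Having at least three vertices
  makes the successor and the predecessor of each one distinct.\<close>

lemma ex_two_regular: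
  assumes "finite X" "card X \<ge> 3"
  shows "\<exists>C. (\<forall>e\<in>C. e \<subseteq> X \<and> card e = 2) \<and> (\<forall>v\<in>X. card {u. {v, u} \<in> C} = 2)"
proof -
  define m where "m = card X"
  have m: "m \<ge> 3" using assms m_def by simp
  obtain h where h: "bij_betw h {..<m} X"
    using ex_bij_betw_nat_finite[OF assms(1)] by (auto simp: m_def atLeast0LessThan)
  have inj: "h i = h j \<longleftrightarrow> i = j" if "i < m" "j < m" for i j
    using h that by (auto simp: bij_betw_def inj_on_def)
  define succ where "succ i = (if Suc i = m then 0 else Suc i)" for i
  define pre where "pre i = (if i = 0 then m - 1 else i - 1)" for i
  have sp: "succ i < m" "pre i < m" "succ i \<noteq> i" "pre i \<noteq> succ i" if "i < m" for i
    using that m by (auto simp: succ_def pre_def split: if_splits)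
  have ps: "i = succ j \<longleftrightarrow> j = pre i" if "i < m" "j < m" for i j
    using that m by (auto simp: succ_def pre_def split: if_splits)
  have hX: "h i \<in> X" if "i < m" for i using h that by (auto simp: bij_betw_def)
  define C where "C = (\<lambda>i. {h i, h (succ i)}) ` {..<m}"
  show ?thesis
  proof (intro exI[of _ C] conjI ballI)
    fix e assume "e \<in> C"
    then obtain i where i: "i < m" "e = {h i, h (succ i)}" by (auto simp: C_def)
    then have "succ i < m" "h i \<noteq> h (succ i)" using inj[of i "succ i"] sp[of i] by auto
    then show "e \<subseteq> X" "card e = 2" using hX i by auto
  next
    fix v assume "v \<in> X"
    then obtain j where j: "j < m" "v = h j" using h by (auto simp: bij_betw_def)
    have "{u. {v, u} \<in> C} = {h (succ j), h (pre j)}"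
    proof (intro set_eqI iffI)
      fix u assume "u \<in> {u. {v, u} \<in> C}"
      then obtain i where i: "i < m" "{v, u} = {h i, h (succ i)}" by (auto simp: C_def)
      then consider "v = h i" "u = h (succ i)" | "v = h (succ i)" "u = h i"
        unfolding doubleton_eq_iff by blast
      then show "u \<in> {h (succ j), h (pre j)}"
      proof cases
        case 1
        then have "i = j" using inj[OF i(1) j(1)] j(2) by metis
        then show ?thesis using 1(2) by blast
      next
        case 2
        then have "j = succ i" using inj[OF j(1) sp(1)[OF i(1)]] j(2) by metis
        then have "i = pre j" using ps[OF j(1) i(1)] by metis
        then show ?thesis using 2(2) by blast
      qed
    next
      fix u assume "u \<in> {h (succ j), h (pre j)}"
      \<comment> \<open>The edge from \<open>h j\<close> back to its predecessor is the one indexed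
        by \<open>pre j\<close>.\<close>
      moreover have "succ (pre j) = j" using ps[OF j(1) sp(2)[OF j(1)]] by simp
      ultimately show "u \<in> {u. {v, u} \<in> C}"
        using j(2) rev_image_eqI[of j "{..<m}" "{v, u}" "\<lambda>i. {h i, h (succ i)}"]
          rev_image_eqI[of "pre j" "{..<m}" "{v, u}" "\<lambda>i. {h i, h (succ i)}"] j(1) sp(2)[OF j(1)]
        by (auto simp: C_def insert_commute)
    qed
    then show "card {u. {v, u} \<in> C} = 2"
      using sp[OF j(1)] inj[OF sp(2)[OF j(1)] sp(1)[OF j(1)]] by (simp add: card_insert_if)
  qed
qed

lemma ex_balanced_join:
  assumes T: "finite T" "card T = 3" and X: "finite X" "card X = m" "m \<ge> 3" and d: "T \<inter> X = {}"
  obtains H where "simple_graph H" "verts H = T \<union> X" "distance_balanced H"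
    "\<And>t x. t \<in> T \<Longrightarrow> x \<in> X \<Longrightarrow> {t, x} \<in> edges H" "2 * card (edges H) = m * (m + 3)"
proof -
  obtain C where C: "\<And>e. e \<in> C \<Longrightarrow> e \<subseteq> X \<and> card e = 2"
    and C2: "\<And>v. v \<in> X \<Longrightarrow> card {u. {v, u} \<in> C} = 2"
    using ex_two_regular[of X] X by auto
  \<comment> \<open>All pairs except those inside \<open>T\<close> and those in \<open>C\<close>. A
    vertex of \<open>T\<close> sees exactly the m vertices of \<open>X\<close>; a vertex of
    \<open>X\<close> misses only itself and its two neighbours in \<open>C\<close>, leaving (m + 3)
    - 3 = m.\<close>
  define H where "H = Graph (T \<union> X) ({e. e \<subseteq> T \<union> X \<and> card e = 2 \<and> \<not> e \<subseteq> T} - C)"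
  have V: "verts H = T \<union> X" by (simp add: H_def)
  have s: "simple_graph H" using T X by (auto simp: simple_graph_def H_def)
  have E: "{t, x} \<in> edges H" if "t \<in> T" "x \<in> X" for t x
    using that d C[of "{t, x}"] by (auto simp: H_def card_insert_if)
  have nT: "nbrs H v = X" if "v \<in> T" for v
    using that d C[of "{v, _}"] by (auto simp: nbrs_def H_def card_insert_if)
  have nX: "nbrs H v = T \<union> X - insert v {u. {v, u} \<in> C}" if "v \<in> X" for v
    using that d by (auto simp: nbrs_def H_def card_insert_if)
  have deg: "degree H v = m" if "v \<in> verts H" for v
  proof (cases "v \<in> T")
    case True
    then show ?thesis using nT card_nbrs[OF s] X by metis
  next
    case False
    then have v: "v \<in> X" using that V by simp
    let ?N = "{u. {v, u} \<in> C}"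
    have N: "?N \<subseteq> X" "v \<notin> ?N" using C[of "{v, _}"] C[of "{v}"] by auto
    have f: "finite ?N" using N X finite_subset by blast
    have "card (T \<union> X - insert v ?N) = card (T \<union> X) - card (insert v ?N)"
      using N v f by (intro card_Diff_subset) auto
    also have "\<dots> = m" using N f C2[OF v] T X d by (simp add: card_Un_disjoint)
    finally show ?thesis using nX[OF v] card_nbrs[OF s] by metis
  qed
  \<comment> \<open>Common neighbours for vertices on the same side: \<open>t\<close> serves any two
    in \<open>X\<close>, and \<open>x\<close> any two in \<open>T\<close>.\<close>
  obtain t x where tx: "t \<in> T" "x \<in> X" using T X by fastforce
  have far: "far H v = {}" if "v \<in> verts H" for v
  proof -
    have "gdist H u v < enat 3" if u: "u \<in> verts H" for u
    proof -
      consider "u \<in> T" "v \<in> T" | "u \<in> T" "v \<in> X" | "u \<in> X" "v \<in> T" | "u \<in> X" "v \<in> X"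
        using u \<open>v \<in> verts H\<close> V by auto
      then have "u \<in> nbrs H v \<or> (\<exists>w. w \<in> nbrs H u \<and> w \<in> nbrs H v)"
        by cases (use nT tx nbrs_sym in \<open>metis+\<close>)
      then show ?thesis using gdist_less_3[OF s] u by blast
    qed
    then show ?thesis by (auto simp: far_def)
  qed
  have "2 * card (edges H) = m * (m + 3)"
    using handshake[OF s] deg V T X d by (simp add: card_Un_disjoint algebra_simps)
  then show ?thesis
    using that s V E regular_diameter_2_balanced[OF s deg far] by blast
qed

section \<open>The minimum for bipartite graphs with a vertex joined to the whole opposite
  part\<close>

text \<open>Isolates what is used of the tree: \<open>E\<close> places \<open>G\<close> inside the
  extremal join, while \<open>c\<close> and \<open>N\<close> keep every vertex within distance 2 of
  \<open>c\<close> in any supergraph on the same vertices. The additive form avoids truncated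
  subtraction.\<close>

lemma db_number_spanning_star_bipartite:
  assumes s: "simple_graph G" and V: "verts G = T \<union> X" and T: "finite T" "card T = 3"
    and X: "finite X" "card X = m" "m \<ge> 3" and d: "T \<inter> X = {}"
    and E: "\<And>e. e \<in> edges G \<Longrightarrow> \<exists>t\<in>T. \<exists>x\<in>X. e = {t, x}"
    and c: "c \<in> T" "\<And>x. x \<in> X \<Longrightarrow> {c, x} \<in> edges G"
    and N: "\<And>t. t \<in> T \<Longrightarrow> \<exists>x\<in>X. {t, x} \<in> edges G"
  shows "2 * (db_number G + card (edges G)) = m * (m + 3)"
proof -
  have sF: "simple_graph (add_edges G F)" "verts (add_edges G F) = verts G"
    "edges (add_edges G F) = edges G \<union> F"
    "card (edges (add_edges G F)) = card (edges G) + card F" if F: "F \<subseteq> non_edges G" for F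
  proof -
    show *: "simple_graph (add_edges G F)"
      using s F by (auto simp: simple_graph_def add_edges_def non_edges_def)
    show "verts (add_edges G F) = verts G" "edges (add_edges G F) = edges G \<union> F"
      by (auto simp: add_edges_def)
    moreover have "edges G \<inter> F = {}" using F by (auto simp: non_edges_def)
    ultimately show "card (edges (add_edges G F)) = card (edges G) + card F"
      using finite_edges[OF *] by (simp add: card_Un_disjoint)
  qed
  obtain H where H: "simple_graph H" "verts H = T \<union> X" "distance_balanced H"
    "\<And>t x. t \<in> T \<Longrightarrow> x \<in> X \<Longrightarrow> {t, x} \<in> edges H" "2 * card (edges H) = m * (m + 3)"
    using ex_balanced_join[OF T X d] by metis
  have sub: "edges G \<subseteq> edges H" using E H(4) by blast
  \<comment> \<open>The witness for the upper bound: exactly the edges that complete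
    \<open>G\<close> to the extremal graph.\<close>
  define F where "F = edges H - edges G"
  have F: "F \<subseteq> non_edges G" using H V by (auto simp: F_def non_edges_def simple_graph_def)
  have "add_edges G F = H"
    using sub H V by (cases H) (auto simp: add_edges_def F_def)
  then have HF: "distance_balanced (add_edges G F)" "2 * (card F + card (edges G)) = m * (m + 3)"
    using H sF[OF F] by simp_all
  have "db_number G = card F"
    unfolding db_number_def
  proof (rule Least_equality)
    show "\<exists>F'. F' \<subseteq> non_edges G \<and> card F' = card F \<and> distance_balanced (add_edges G F')"
      using F HF by blast
  next
    fix k assume "\<exists>F'. F' \<subseteq> non_edges G \<and> card F' = k \<and> distance_balanced (add_edges G F')"
    then obtain F' where F': "F' \<subseteq> non_edges G" "card F' = k" "distance_balanced (add_edges G F')"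
      by blast
    let ?H = "add_edges G F'"
    note sF' = sF[OF F'(1)]
    \<comment> \<open>Added edges can only enlarge neighbourhoods and shorten distances, so
      \<open>c\<close> still meets the hypotheses of the lower bound.\<close>
    have nc: "X \<subseteq> nbrs ?H c" using c sF' by (auto simp: nbrs_def)
    have "far ?H c = {}"
    proof -
      have "gdist ?H u c < enat 3" if u: "u \<in> verts ?H" for u
      proof (cases "u \<in> X")
        case True
        then show ?thesis using nc u gdist_less_3[OF sF'(1)] by blast
      next
        case False
        then have "u \<in> T" using u sF' V by simp
        then obtain x where "x \<in> X" "{u, x} \<in> edges G" using N by blast
        then have "x \<in> nbrs ?H u" "x \<in> nbrs ?H c" using nc sF' by (auto simp: nbrs_def)
        then show ?thesis using u gdist_less_3[OF sF'(1)] by blast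
      qed
      then show ?thesis by (auto simp: far_def)
    qed
    moreover have "degree ?H c \<ge> m"
      using card_mono[OF finite_nbrs[OF sF'(1)] nc] card_nbrs[OF sF'(1)] X by simp
    moreover have "card (verts ?H) = m + 3"
      using sF' V T X d by (simp add: card_Un_disjoint)
    ultimately have "2 * card (edges ?H) \<ge> m * (m + 3)"
      using c sF' V by (intro balanced_edges_ge[OF sF'(1) F'(3)]) auto
    then show "card F \<le> k" using HF(2) F'(2) sF' by simp
  qed
  then show ?thesis using HF by simp
qed

section \<open>Components as classes of the reachability relation\<close>

text \<open>As a relation, adjacency has a reflexive transitive closure that describes reachability
  by walks; this frees arguments from the distinctness built into \<open>path\<close>.\<close>

definition adj_rel :: "'a graph \<Rightarrow> ('a \<times> 'a) set" where
  "adj_rel G = {(a, b). {a, b} \<in> edges G}"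

lemma path_suffix: "path G (ys @ zs) \<Longrightarrow> zs \<noteq> [] \<Longrightarrow> path G zs"
proof (induction ys)
  case (Cons a ys)
  then show ?case by (cases "ys @ zs") (auto simp: path_Cons_Cons)
qed simp

lemma path_imp_rtrancl: "path G p \<Longrightarrow> (hd p, last p) \<in> (adj_rel G)\<^sup>*"
proof (induction p)
  case (Cons a p)
  then show ?case
    by (cases p) (auto simp: path_Cons_Cons adj_rel_def intro: converse_rtrancl_into_rtrancl)
qed (simp add: path_def)

lemma rtrancl_imp_path_between:
  assumes s: "simple_graph G" and v: "v \<in> verts G" and r: "(u, v) \<in> (adj_rel G)\<^sup>*"
  shows "\<exists>p. path_between G u v p"
  using r
proof (induction rule: converse_rtrancl_induct)
  case base
  then show ?case using v path_between_singleton by metis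
next
  case (step a b)
  then obtain p where p: "path G p" "hd p = b" "last p = v" by (auto simp: path_between_def)
  have ab: "{a, b} \<in> edges G" using step by (simp add: adj_rel_def)
  show ?case
  proof (cases "a \<in> set p")
    case True
    \<comment> \<open>When \<open>a\<close> recurs on the path, the part before it is cut off, which
      keeps the vertices distinct.\<close>
    then obtain ys zs where "p = ys @ a # zs" by (meson split_list)
    with p show ?thesis by (auto simp: path_between_def dest: path_suffix intro!: exI[of _ "a # zs"])
  next
    case False
    have "p \<noteq> []" using p by (auto simp: path_def)
    then obtain q where "p = b # q" using p by (cases p) auto
    with p False ab edgeD[OF s ab] show ?thesis
      by (auto simp: path_between_def path_Cons_Cons intro!: exI[of _ "a # p"])
  qed
qed

lemma rtrancl_verts:
  assumes "simple_graph G" "(u, v) \<in> (adj_rel G)\<^sup>*" "u \<in> verts G"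
  shows "v \<in> verts G"
  using assms(2,3) by (induction rule: rtrancl_induct) (auto simp: adj_rel_def dest: edgeD[OF assms(1)])

lemma sym_adj_rel: "sym (adj_rel G)"
  by (auto simp: sym_def adj_rel_def insert_commute)

lemma components_eq:
  assumes "simple_graph G"
  shows "components G = (\<lambda>u. (adj_rel G)\<^sup>* `` {u}) ` verts G"
  unfolding components_def
proof (rule image_cong)
  fix u assume u: "u \<in> verts G"
  show "{v \<in> verts G. \<exists>p. path_between G u v p} = (adj_rel G)\<^sup>* `` {u}"
  proof (intro set_eqI iffI)
    fix v assume "v \<in> {v \<in> verts G. \<exists>p. path_between G u v p}"
    then show "v \<in> (adj_rel G)\<^sup>* `` {u}" using path_imp_rtrancl by (fastforce simp: path_between_def)
  next
    fix v assume "v \<in> (adj_rel G)\<^sup>* `` {u}"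
    then show "v \<in> {v \<in> verts G. \<exists>p. path_between G u v p}"
      using rtrancl_verts[OF assms _ u] rtrancl_imp_path_between[OF assms] by blast
  qed
qed simp

lemma component_eqI:
  assumes "simple_graph G" "A \<in> components G" "B \<in> components G" "x \<in> A" "x \<in> B"
  shows "A = B"
proof -
  obtain a b where "A = (adj_rel G)\<^sup>* `` {a}" "B = (adj_rel G)\<^sup>* `` {b}"
    using assms(2,3) unfolding components_eq[OF assms(1)] by blast
  \<comment> \<open>The closure is reflexive on the whole type, so it is an equivalence on
    \<open>UNIV\<close> and not only on the vertices.\<close>
  moreover have "equiv UNIV ((adj_rel G)\<^sup>*)"
    by (simp add: equiv_def refl_rtrancl trans_rtrancl sym_adj_rel sym_rtrancl)
  ultimately show ?thesis
    using assms(4,5) equiv_class_eq[of UNIV "(adj_rel G)\<^sup>*" a x]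
      equiv_class_eq[of UNIV "(adj_rel G)\<^sup>*" b x] by simp
qed

lemma Union_components: "simple_graph G \<Longrightarrow> \<Union> (components G) = verts G"
  by (auto simp: components_eq intro: rtrancl_verts)

lemma component_edge:
  assumes "simple_graph G" "A \<in> components G" "x \<in> A" "{x, y} \<in> edges G"
  shows "y \<in> A"
proof -
  obtain a where "A = (adj_rel G)\<^sup>* `` {a}" using assms components_eq by blast
  moreover have "(x, y) \<in> adj_rel G" using assms by (simp add: adj_rel_def)
  ultimately show ?thesis using assms(3) by (auto intro: rtrancl_into_rtrancl)
qed

text \<open>A walk from \<open>u\<close> to \<open>c\<close> is followed until just before its first
  visit to \<open>c\<close>. The condition \<open>u \<noteq> c\<close> sits in the conclusion
  because the start varies during the induction.\<close>

lemma rtrancl_delete_vertex: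
  assumes s: "simple_graph G" and r: "(u, c) \<in> (adj_rel G)\<^sup>*"
  shows "u \<noteq> c \<longrightarrow> (\<exists>x. (u, x) \<in> (adj_rel (delete_vertex G c))\<^sup>* \<and> {c, x} \<in> edges G)"
  using r
proof (induction rule: converse_rtrancl_induct)
  case (step a b)
  have ab: "{a, b} \<in> edges G" using step by (simp add: adj_rel_def)
  show ?case
  proof (cases "b = c")
    case True
    with ab show ?thesis by (auto simp: insert_commute)
  next
    case False
    show ?thesis
    proof
      assume "a \<noteq> c"
      then have "(a, b) \<in> adj_rel (delete_vertex G c)"
        using ab False edgeD[OF s ab]
        by (auto simp: adj_rel_def delete_vertex_def induced_subgraph_def)
      with step.IH False show "\<exists>x. (a, x) \<in> (adj_rel (delete_vertex G c))\<^sup>* \<and> {c, x} \<in> edges G"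
        by (meson converse_rtrancl_into_rtrancl)
    qed
  qed
qed simp

text \<open>An enumeration of two vertices has a single consecutive pair, so a component of two
  vertices can be used directly as an edge.\<close>

lemma path_graph_pair:
  assumes "path_graph G" "card (verts G) = 2"
  shows "verts G \<in> edges G"
proof -
  obtain p where p: "distinct p" "verts G = set p" "edges G = {{p ! i, p ! Suc i} | i. Suc i < length p}"
    using assms(1) by (auto simp: path_graph_def)
  then have "length p = 2" using assms(2) distinct_card by metis
  then obtain a b where "p = [a, b]" by (auto simp: numeral_2_eq_2 length_Suc_conv)
  with p show ?thesis by force
qed

section \<open>The structure of the starlike tree and the final count\<close>

theorem theorem4p2:
  fixes G :: "'a graph" and m :: nat
  assumes "m \<ge> 3"
    and "starlike G (replicate_mset 2 2 + replicate_mset (m - 2) 1)"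
  shows "real (db_number G) = ((real m)\<^sup>2 + real m - 4) / 2"
proof -
  let ?N = "replicate_mset 2 2 + replicate_mset (m - 2) (1::nat)"
  have t: "tree G" using assms(2) by (simp add: starlike_def)
  then have s: "simple_graph G" by (simp add: tree_def)
  obtain c where c: "c \<in> verts G"
    and pg: "\<And>A. A \<in> components (delete_vertex G c) \<Longrightarrow>
      path_graph (induced_subgraph (delete_vertex G c) A)"
    and N: "image_mset card (mset_set (components (delete_vertex G c))) = ?N"
    using assms(2) unfolding starlike_def by blast
  define D where "D = delete_vertex G c"
  define K where "K = components D"
  have VD: "verts D = verts G - {c}" and ED: "edges D = {e \<in> edges G. c \<notin> e}"
    using s by (auto simp: D_def delete_vertex_def induced_subgraph_def simple_graph_def)
  have sD: "simple_graph D" using s by (auto simp: simple_graph_def VD ED)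
  have finV: "finite (verts G)" using s by (simp add: simple_graph_def)
  have UK: "\<Union> K = verts G - {c}" using Union_components[OF sD] by (simp add: K_def VD)
  have finK: "finite K" using UK finV by (intro finite_UnionD) auto
  note disj = component_eqI[OF sD, folded K_def]
  have card_set: "card A = 1 \<or> card A = 2" if "A \<in> K" for A
  proof -
    have "card A \<in># image_mset card (mset_set K)" using that finK by simp
    then show ?thesis using N by (auto simp: K_def D_def split: if_splits)
  qed
  \<comment> \<open>Size, sum and multiplicity of 2 in \<open>?N\<close> give the number of
    components, the number of vertices other than \<open>c\<close>, and the number of two-vertex
    components.\<close>
  have cardK: "card K = m"
    using arg_cong[OF N, of size] assms(1) by (simp add: K_def D_def)
  have sumK: "sum card K = m + 2"
    using arg_cong[OF N, of sum_mset] assms(1) by (simp add: K_def D_def sum_unfold_sum_mset)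
  have "card {A \<in> K. card A = 2} = count (image_mset card (mset_set K)) 2"
    unfolding count_image_mset' card_eq_sum using finK by (intro sum.cong) auto
  then have card2: "card {A \<in> K. card A = 2} = 2" using N by (simp add: K_def D_def)
  have pair: "A \<in> edges G" if A: "A \<in> K" "card A = 2" for A
  proof -
    have "verts (induced_subgraph D A) = A"
      using A UK by (auto simp: induced_subgraph_def VD)
    then have "A \<in> edges (induced_subgraph D A)"
      using path_graph_pair pg A by (metis D_def K_def)
    then show ?thesis by (simp add: induced_subgraph_def ED)
  qed
  \<comment> \<open>Connectedness of the tree: a walk from the component to \<open>c\<close> leaves
    the component through a neighbour of \<open>c\<close>.\<close>
  have "\<exists>x\<in>A. {c, x} \<in> edges G" if A: "A \<in> K" for A
  proof -
    obtain u where u: "u \<in> verts G" "u \<noteq> c" "A = (adj_rel D)\<^sup>* `` {u}"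
      using A VD by (auto simp: K_def components_eq[OF sD])
    obtain p where "path_between G u c p"
      using t c u(1) unfolding tree_def connected_graph_def by blast
    then have "path G p" "hd p = u" "last p = c" by (simp_all add: path_between_def)
    then have "(u, c) \<in> (adj_rel G)\<^sup>*" using path_imp_rtrancl by metis
    then show ?thesis using rtrancl_delete_vertex[OF s] u by (auto simp: D_def)
  qed
  then obtain r where r: "\<And>A. A \<in> K \<Longrightarrow> r A \<in> A \<and> {c, r A} \<in> edges G" by metis
  \<comment> \<open>As \<open>A\<close> has at most two vertices, a second neighbour of
    \<open>c\<close> in it would be adjacent to \<open>r A\<close> and close a triangle in the
    tree.\<close>
  have uniq: "x = r A" if x: "A \<in> K" "x \<in> A" "{c, x} \<in> edges G" for x A
  proof (rule ccontr)
    assume n: "x \<noteq> r A"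
    have rA: "r A \<in> A" "{c, r A} \<in> edges G" using r x by auto
    have "finite A" using x UK finV by (metis Sup_upper finite_Diff finite_subset)
    then have "card A = 2" "A = {x, r A}"
      using card_set[OF x(1)] x n rA card_seteq[of A "{x, r A}"] by (auto simp: card_1_singleton_iff)
    then have "{x, r A} \<in> edges G" using pair x by metis
    then have "cycle G [c, x, r A]"
      using n x rA edgeD[OF s x(3)] edgeD[OF s rA(2)]
      by (auto simp: cycle_def path_Cons_Cons path_single insert_commute)
    then show False using t by (auto simp: tree_def)
  qed
  \<comment> \<open>\<open>X\<close> consists of the neighbours of the centre; \<open>T\<close> will
    turn out to be the centre together with the two leaves at distance 2.\<close>
  define X where "X = r ` K"
  define T where "T = verts G - X"
  have XV: "X \<subseteq> verts G - {c}" using r unfolding X_def UK[symmetric] by blast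
  have "inj_on r K" using r disj by (metis inj_onI)
  then have cX: "card X = m" "finite X" using cardK finK by (auto simp: X_def card_image)
  have "card (verts G - {c}) = m + 2"
  proof -
    have "card (\<Union> K) = sum card K"
      using disj UK finV by (intro card_Union_disjoint) (auto simp: pairwise_def disjnt_def intro: finite_subset)
    then show ?thesis using UK sumK by simp
  qed
  then have cV: "card (verts G) = m + 3" using c finV card_Suc_Diff1[of "verts G" c] by simp
  have cT: "card T = 3" "finite T"
    using cV cX card_Diff_subset[OF cX(2) order.trans[OF XV Diff_subset]] finV by (auto simp: T_def)
  \<comment> \<open>A component of size 2 is, as a set, itself an edge of \<open>G\<close>.\<close>
  have edge_cases: "(\<exists>x\<in>X. e = {c, x}) \<or> e \<in> K \<and> card e = 2" if e: "e \<in> edges G" for e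
  proof -
    have ce: "card e = 2" "e \<subseteq> verts G" using e s by (auto simp: simple_graph_def)
    show ?thesis
    proof (cases "c \<in> e")
      case True
      then obtain x where x: "e = {c, x}" "x \<noteq> c" using ce by (auto simp: card_2_iff)
      then have "x \<in> \<Union> K" using ce UK by auto
      then show ?thesis using x e uniq by (auto simp: X_def)
    next
      case False
      obtain a b where ab: "e = {a, b}" using ce by (auto simp: card_2_iff)
      then obtain A where A: "A \<in> K" "a \<in> A" using ce UK False by auto
      have "b \<in> A" using component_edge[OF sD, of A a b] A ab e False by (auto simp: K_def ED)
      moreover have "finite A" using A UK finV by (metis Sup_upper finite_Diff finite_subset)
      ultimately have "e = A" using card_set[OF A(1)] ab A ce by (intro card_seteq) auto
      then show ?thesis using A ce by simp
    qed
  qed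
  have pair_TX: "\<exists>t. t \<in> T \<and> A = {t, r A}" if A: "A \<in> K" "card A = 2" for A
  proof -
    obtain t where t: "A = {t, r A}" "t \<noteq> r A"
      using A r by (metis card_2_iff insert_iff insert_commute singletonD)
    \<comment> \<open>Components are disjoint, so \<open>r A\<close> is the only vertex of
      \<open>X\<close> inside \<open>A\<close>.\<close>
    have "t \<notin> X"
    proof
      assume "t \<in> X"
      then obtain B where "B \<in> K" "t = r B" by (auto simp: X_def)
      then show False using t r[of B] r[of A] disj[of A B t] A by auto
    qed
    then show ?thesis using t A UK by (auto simp: T_def)
  qed
  have "2 * (db_number G + card (edges G)) = m * (m + 3)"
  proof (rule db_number_spanning_star_bipartite[OF s _ cT(2,1) cX(2,1) assms(1)])
    show "verts G = T \<union> X" "T \<inter> X = {}" using XV by (auto simp: T_def)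
    show cT: "c \<in> T" using c XV by (auto simp: T_def)
    show "\<exists>t\<in>T. \<exists>x\<in>X. e = {t, x}" if "e \<in> edges G" for e
      using edge_cases[OF that] pair_TX[of e] cT unfolding X_def by blast
    show "{c, x} \<in> edges G" if "x \<in> X" for x using that r by (auto simp: X_def)
    show "\<exists>x\<in>X. {t, x} \<in> edges G" if t: "t \<in> T" for t
    proof (cases "t = c")
      case True
      obtain A where "A \<in> K" using cardK assms(1) by fastforce
      then show ?thesis using r True by (auto simp: X_def)
    next
      case False
      then have "t \<in> \<Union> K" using t UK by (auto simp: T_def)
      then obtain A where A: "A \<in> K" "t \<in> A" by auto
      \<comment> \<open>A one-vertex component is \<open>{r A}\<close> and lies in \<open>X\<close>,
        so a vertex of \<open>T\<close> other than \<open>c\<close> belongs to a two-vertex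
        component, which is the required edge.\<close>
      have n: "t \<noteq> r A" using t A by (auto simp: T_def X_def)
      then have A2: "card A = 2" using card_set[OF A(1)] A r[OF A(1)] by (auto simp: card_1_singleton_iff)
      then obtain t' where t': "A = {t', r A}" using pair_TX[OF A(1)] by blast
      then have "t' = t" using A(2) n by (metis insertE singletonD)
      then have "{t, r A} \<in> edges G" using pair[OF A(1) A2] t' by metis
      then show ?thesis using A(1) unfolding X_def by blast
    qed
  qed
  moreover have "card (edges G) = m + 2"
  proof -
    \<comment> \<open>The m edges at the centre and the two-vertex components, of which there are
      two; the latter avoid \<open>c\<close>, so the union is disjoint.\<close>
    have "edges G = (\<lambda>x. {c, x}) ` X \<union> {A \<in> K. card A = 2}"
      using edge_cases pair r by (auto simp: X_def)
    moreover have "(\<lambda>x. {c, x}) ` X \<inter> {A \<in> K. card A = 2} = {}" using UK by auto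
    moreover have "card ((\<lambda>x. {c, x}) ` X) = m"
      using cX by (subst card_image) (auto simp: inj_on_def doubleton_eq_iff)
    ultimately show ?thesis using card2 cX finK by (simp add: card_Un_disjoint)
  qed
  ultimately have "2 * db_number G + 2 * m + 4 = m * (m + 3)" by simp
  \<comment> \<open>The equation is still free of subtraction and division, so it transfers to the
    reals before being solved for \<open>db_number G\<close>.\<close>
  then have "real (2 * db_number G + 2 * m + 4) = real (m * (m + 3))" by (rule arg_cong)
  then show ?thesis by (simp add: power2_eq_square field_simps)
qed

end
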